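(* Let $(\beta_i)_{i=0}^{\infty}$ be a sequence of positive real numbers with $\sum_{i=0}^{\infty}\beta_i<1$, let $\{H_n\}_{n\ge 1}$ be the discrete-time Hawkes process with parameters $(\beta_i)_{i\ge 0}$, and let $\Gamma_n(t)=\frac{1}{n}\log\mathbb{E}(e^{tH_n})$ for $t\in\mathbb{R}$, $n\ge 1$. Then $\Gamma_n$ is pointwise bounded: there exist functions $\phi:\mathbb{R}\to\mathbb{R}$ and $\psi:\mathbb{R}\to\mathbb{R}$ (not depending on $n$) such that $$\phi(t)\le\Gamma_n(t)\le\psi(t)\quad\text{for all } t\in\mathbb{R}\text{ and all } n\ge 1.$$
   Context: Discrete-time Hawkes process (DTHP): on a probability space $(\Omega,\mathcal{F},\mathbb{P})$, let $(\xi_n)_{n\ge 1}$ be $\{0,1\}$-valued random variables with $\mathbb{P}(\xi_1=1)=\beta_0$ and, for $n\ge 2$, $\mathbb{P}(\xi_n=1\mid \xi_1,\ldots,\xi_{n-1})=\beta_0+\sum_{i=1}^{n-1}\beta_{n-i}\xi_i$ (and $\xi_n=0$ with the complementary conditional probability). The DTHP is $H_n=\sum_{i=1}^n\xi_i$, $n\ge 1$. *)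

theory Defs
  imports "HOL-Probability.Probability"
begin

text \<open>The sub-sigma-algebra of \<open>M\<close> generated by \<open>\<xi> 1, \<dots>, \<xi> (n - 1)\<close>, i.e. by the random vector
  with these components.\<close>

definition past :: "'a measure \<Rightarrow> (nat \<Rightarrow> 'a \<Rightarrow> real) \<Rightarrow> nat \<Rightarrow> 'a measure" where
  "past M \<xi> n =
     vimage_algebra (space M) (\<lambda>\<omega>. \<lambda>i\<in>{1..<n}. \<xi> i \<omega>) (\<Pi>\<^sub>M i\<in>{1..<n}. borel)"

text \<open>Indices start at 1; the value \<open>\<xi> 0\<close> is irrelevant. Both \<open>\<xi>\<close> and \<open>H\<close> are real-valued.
  The conditional probability of the event \<open>\<xi> n = 1\<close> given the past is the conditional expectation
  of its indicator function. As \<open>\<xi> n\<close> takes only the values 0 and 1, the event \<open>\<xi> n = 0\<close> then has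
  the complementary conditional probability.\<close>

locale discrete_hawkes = prob_space M
  for M :: "'a measure" and \<beta> :: "nat \<Rightarrow> real" and \<xi> :: "nat \<Rightarrow> 'a \<Rightarrow> real" +
  assumes measurable_jump: "\<And>n. n \<ge> 1 \<Longrightarrow> random_variable borel (\<xi> n)"
    and jump_01: "\<And>n \<omega>. n \<ge> 1 \<Longrightarrow> \<omega> \<in> space M \<Longrightarrow> \<xi> n \<omega> \<in> {0, 1}"
    and prob_first_jump: "prob {\<omega> \<in> space M. \<xi> 1 \<omega> = 1} = \<beta> 0"
    and cond_prob_jump: "\<And>n. n \<ge> 2 \<Longrightarrow>
      (AE \<omega> in M. real_cond_exp M (past M \<xi> n) (indicator {\<omega> \<in> space M. \<xi> n \<omega> = 1}) \<omega>
        = \<beta> 0 + (\<Sum>i = 1..n - 1. \<beta> (n - i) * \<xi> i \<omega>))"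

definition hawkes_count :: "(nat \<Rightarrow> 'a \<Rightarrow> real) \<Rightarrow> nat \<Rightarrow> 'a \<Rightarrow> real" where
  "hawkes_count \<xi> n \<omega> = (\<Sum>i = 1..n. \<xi> i \<omega>)"

definition scaled_log_mgf :: "'a measure \<Rightarrow> (nat \<Rightarrow> 'a \<Rightarrow> real) \<Rightarrow> nat \<Rightarrow> real \<Rightarrow> real" where
  "scaled_log_mgf M H n t = 1 / real n * ln (LINT \<omega>|M. exp (t * H n \<omega>))"

end

theory Submission imports Defs begin

text \<open>
  Since \<open>0 \<le> H n \<le> n\<close> surely, \<open>exp (t * H n)\<close> lies between \<open>exp (- n \<bar>t\<bar>)\<close> and \<open>exp (n \<bar>t\<bar>)\<close>; hence so
  does its expectation, and \<open>\<phi> t = - \<bar>t\<bar>\<close>, \<open>\<psi> t = \<bar>t\<bar>\<close> are suitable bounds.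
\<close>

text \<open>Stated for any process with \<open>\<bar>H n\<bar> \<le> n\<close>; the absolute value
  makes one inequality carry both bounds.\<close>

lemma (in prob_space) abs_scaled_log_mgf_le:
  assumes n: "n \<ge> 1"
    and H: "random_variable borel (H n)"
    and bound: "\<And>\<omega>. \<omega> \<in> space M \<Longrightarrow> \<bar>H n \<omega>\<bar> \<le> real n"
  shows "\<bar>scaled_log_mgf M H n t\<bar> \<le> \<bar>t\<bar>"
proof -
  let ?c = "real n * \<bar>t\<bar>"
  have tH: "\<bar>t * H n \<omega>\<bar> \<le> ?c" if "\<omega> \<in> space M" for \<omega>
    using mult_left_mono[OF bound[OF that], of "\<bar>t\<bar>"] by (simp add: abs_mult mult.commute)
  have lower: "exp (- ?c) \<le> exp (t * H n \<omega>)" and upper: "exp (t * H n \<omega>) \<le> exp ?c"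
    if "\<omega> \<in> space M" for \<omega>
    using tH[OF that] by (simp_all add: abs_le_iff)
  \<comment> \<open>Needed before integrals are compared: the Bochner integral of a non-integrable
    function is 0 by default.\<close>
  have int: "integrable M (\<lambda>\<omega>. exp (t * H n \<omega>))"
    by (rule integrable_const_bound[where B = "exp ?c"]) (use H upper in auto)
  \<comment> \<open>Total mass 1 lets pointwise constant bounds pass unchanged to the
    expectation.\<close>
  have ge: "exp (- ?c) \<le> expectation (\<lambda>\<omega>. exp (t * H n \<omega>))"
    by (rule integral_ge_const[OF int]) (use lower in auto)
  have le: "expectation (\<lambda>\<omega>. exp (t * H n \<omega>)) \<le> exp ?c"
    by (rule integral_le_const[OF int]) (use upper in auto)
  \<comment> \<open>The monotonicity of \<open>ln\<close> used below holds only for positive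
    arguments.\<close>
  have pos: "expectation (\<lambda>\<omega>. exp (t * H n \<omega>)) > 0"
    using ge exp_gt_zero less_le_trans by blast
  \<comment> \<open>The instantiated cancellation rule simplifies to
    \<open>ln x \<le> ?c \<longleftrightarrow> x \<le> exp ?c\<close> for positive
    \<open>x\<close>.\<close>
  have "\<bar>ln (expectation (\<lambda>\<omega>. exp (t * H n \<omega>)))\<bar> \<le> ?c"
    using ge le pos by (simp add: abs_le_iff ln_ge_iff minus_le_iff ln_le_cancel_iff[of _ "exp ?c", simplified])
  then show ?thesis
    using n by (simp add: scaled_log_mgf_def abs_mult divide_simps mult.commute)
qed

context discrete_hawkes
begin

lemma hawkes_count_measurable: "random_variable borel (hawkes_count \<xi> n)"
  unfolding hawkes_count_def[abs_def]
  by (rule borel_measurable_sum) (simp add: measurable_jump)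

text \<open>Triangle inequality over \<open>n\<close> jumps, each 0 or 1 at every point of the space
  and not just almost surely.\<close>

lemma abs_hawkes_count_le:
  assumes "\<omega> \<in> space M"
  shows "\<bar>hawkes_count \<xi> n \<omega>\<bar> \<le> real n"
proof -
  have "\<bar>\<Sum>i = 1..n. \<xi> i \<omega>\<bar> \<le> (\<Sum>i = 1..n. \<bar>\<xi> i \<omega>\<bar>)"
    by (rule sum_abs)
  also have "\<dots> \<le> (\<Sum>i = 1..n. 1)"
    by (rule sum_mono) (use jump_01 assms in fastforce)
  finally show ?thesis
    by (simp add: hawkes_count_def)
qed

end

theorem theorem6p1:
  fixes M :: "'a measure" and \<beta> :: "nat \<Rightarrow> real" and \<xi> :: "nat \<Rightarrow> 'a \<Rightarrow> real"
  assumes "\<And>i. \<beta> i > 0"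
    and "summable \<beta>"
    and "(\<Sum>i. \<beta> i) < 1"
    and "discrete_hawkes M \<beta> \<xi>"
  shows "\<exists>\<phi> \<psi> :: real \<Rightarrow> real. \<forall>t. \<forall>n\<ge>1.
    \<phi> t \<le> scaled_log_mgf M (hawkes_count \<xi>) n t \<and>
    scaled_log_mgf M (hawkes_count \<xi>) n t \<le> \<psi> t"
proof -
  interpret discrete_hawkes M \<beta> \<xi>
    by fact
  \<comment> \<open>The bound is free of \<open>n\<close>, so both witnesses can be fixed before
    \<open>n\<close>.\<close>
  have "\<bar>scaled_log_mgf M (hawkes_count \<xi>) n t\<bar> \<le> \<bar>t\<bar>" if "n \<ge> 1" for n t
    using that hawkes_count_measurable abs_hawkes_count_le by (rule abs_scaled_log_mgf_le)
  then show ?thesis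
    by (intro exI[of _ "\<lambda>t. - \<bar>t\<bar>"] exI[of _ abs]) (auto simp: abs_le_iff minus_le_iff)
qed

end
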